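(* Assume: (A1) $X\subset\mathbb{R}^d$ is a nonempty closed convex set onto which the projection can be easily computed; (A2) $f:\mathbb{R}^d\to\mathbb{R}$, $f(\mathbf{x}):=\mathbb{E}[F(\mathbf{x},\boldsymbol{\xi})]$, is well defined, where $F(\cdot,\boldsymbol{\xi})$ is continuously differentiable for almost every $\boldsymbol{\xi}\in\Xi$; (A3) $h_{n+1,i}\ge h_{n,i}$ almost surely for all $n\in\mathbb{N}$ and all $i=1,\dots,d$; (A4) for all $i=1,\dots,d$ there is a positive number $B_i$ with $\sup\{\mathbb{E}[h_{n,i}]:n\in\mathbb{N}\}\le B_i$; (A5) $D:=\max_{i=1,\dots,d}\sup\{(x_i-y_i)^2:(x_j)_j,(y_j)_j\in X\}<+\infty$; (C1) $\boldsymbol{\xi}_0,\boldsymbol{\xi}_1,\dots$ is an independent and identically distributed sample of realizations of $\boldsymbol{\xi}$; (C2) there is an oracle which, for a given $(\mathbf{x},\boldsymbol{\xi})\in\mathbb{R}^d\times\Xi$, returns a stochastic gradient $\mathsf{G}(\mathbf{x},\boldsymbol{\xi})$ with $\mathbb{E}[\mathsf{G}(\mathbf{x},\boldsymbol{\xi})]=\nabla f(\mathbf{x})$; (C3) there is a positive number $M$ such that $\mathbb{E}[\|\mathsf{G}(\mathbf{x},\boldsymbol{\xi})\|^2]\le M^2$ for all $\mathbf{x}\in X$. Suppose also that $F(\cdot,\boldsymbol{\xi})$ is convex for almost every $\boldsymbol{\xi}\in\Xi$, and let $(\mathbf{x}_n)_{n\in\mathbb{N}}$ be the sequence generated by the algorithm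 described in the context with $\alpha_n:=\alpha\in(0,1)$ and $\beta_n:=\beta\in[0,1)$ for all $n\in\mathbb{N}$, and with $\gamma\in[0,1)$. Then $$\liminf_{n\to+\infty}\mathbb{E}\left[f(\mathbf{x}_n)-f^\star\right]\ \le\ \frac{\tilde B^2\tilde M^2}{2\tilde b\tilde\gamma^2}\,\alpha+\frac{\tilde M\sqrt{Dd}}{\tilde b\tilde\gamma}\,\beta,$$ where $f^\star$ denotes the optimal value of the problem of minimizing $f$ over $X$, $\tilde\gamma:=1-\gamma$, $\tilde b:=1-\beta$, $\tilde M^2:=\max\{\|\mathbf{m}_{-1}\|^2,M^2\}$ (with $\tilde M\ge0$), and $\tilde B:=\sup\{\max_{i=1,\dots,d}h_{n,i}^{-1/2}:n\in\mathbb{N}\}<+\infty$.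
   Context: $\mathbb{N}=\{0,1,2,\dots\}$; $\langle\cdot,\cdot\rangle$ and $\|\cdot\|$ are the Euclidean inner product and norm on $\mathbb{R}^d$. For a symmetric positive-definite matrix $H$, $\|\mathbf{x}\|_H^2:=\langle\mathbf{x},H\mathbf{x}\rangle$, and $P_{X,H}$ is the metric projection onto $X$ under the norm $\|\cdot\|_H$. $\boldsymbol{\xi}$ is a random vector whose distribution is supported on a set $\Xi\subset\mathbb{R}^{d_1}$, and $\nabla f$ is the gradient of $f$. Algorithm. Parameters: $(\alpha_n)_{n\in\mathbb{N}}\subset(0,1)$, $(\beta_n)_{n\in\mathbb{N}}\subset[0,1)$, $\gamma\in[0,1)$. Initialize with $\mathbf{x}_0,\mathbf{m}_{-1}\in\mathbb{R}^d$ and a symmetric positive-definite diagonal $d\times d$ matrix $\mathsf{H}_0$. For $n=0,1,2,\dots$: set $$\mathbf{m}_n:=\beta_n\mathbf{m}_{n-1}+(1-\beta_n)\mathsf{G}(\mathbf{x}_n,\boldsymbol{\xi}_n),\qquad \hat{\mathbf{m}}_n:=\frac{\mathbf{m}_n}{1-\gamma^{n+1}};$$ take a (possibly random) symmetric positive-definite diagonal matrix $\mathsf{H}_n=\mathrm{diag}(h_{n,1},\dots,h_{n,d})$, $h_{n,i}>0$; find $\mathbf{d}_n\in\mathbb{R}^d$ solving $\mathsf{H}_n\mathbf{d}=-\hat{\mathbf{m}}_n$; set $\mathbf{x}_{n+1}:=P_{X,\mathsf{H}_n}(\mathbf{x}_n+\alpha_n\mathbf{d}_n)$. The iterate $\mathbf{x}_n$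 is a function of $(\boldsymbol{\xi}_0,\dots,\boldsymbol{\xi}_{n-1})$. *)

theory Defs
  imports "HOL-Probability.Probability"
begin

definition diag_matrix :: "real^'d \<Rightarrow> real^'d^'d" where
  "diag_matrix h = (\<chi> i j. if i = j then h $ i else 0)"

definition matrix_norm_of :: "real^'d^'d \<Rightarrow> real^'d \<Rightarrow> real" where
  "matrix_norm_of H x = sqrt (x \<bullet> (H *v x))"

text \<open>The metric projection \<open>P\<^bsub>X,H\<^esub>\<close>; compare \<^const>\<open>closest_point\<close>, which is the case of
  the identity matrix.\<close>

definition metric_proj :: "(real^'d) set \<Rightarrow> real^'d^'d \<Rightarrow> real^'d \<Rightarrow> real^'d" where
  "metric_proj X H x = (SOME p. p \<in> X \<and>
     (\<forall>y\<in>X. matrix_norm_of H (x - p) \<le> matrix_norm_of H (x - y)))"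

definition cont_differentiable :: "(real^'d \<Rightarrow> real) \<Rightarrow> bool" where
  "cont_differentiable g \<longleftrightarrow> (\<exists>g'. (\<forall>x. GDERIV g x :> g' x) \<and> continuous_on UNIV g')"

text \<open>One sample path of the algorithm. The sequence \<open>xi\<close> holds the realized samples, \<open>h n\<close> is
  the diagonal of the matrix chosen in step \<open>n\<close>, and \<open>x\<close> is the resulting sequence of iterates.
  The momentum vector of index \<open>-1\<close> is the separate argument \<open>m_init\<close>, so that \<open>m n\<close> is the
  momentum of step \<open>n\<close>.\<close>

definition adaptive_run ::
  "(real^'d) set \<Rightarrow> (real^'d \<Rightarrow> 'e \<Rightarrow> real^'d) \<Rightarrow> (nat \<Rightarrow> real) \<Rightarrow> (nat \<Rightarrow> real) \<Rightarrow> real \<Rightarrow>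
   real^'d \<Rightarrow> real^'d \<Rightarrow> (nat \<Rightarrow> 'e) \<Rightarrow> (nat \<Rightarrow> real^'d) \<Rightarrow> (nat \<Rightarrow> real^'d) \<Rightarrow> bool" where
  "adaptive_run X G \<alpha> \<beta> \<gamma> x_init m_init xi h x \<longleftrightarrow>
     x 0 = x_init \<and>
     (\<exists>m mhat d. \<forall>n.
        m n = \<beta> n *\<^sub>R (case n of 0 \<Rightarrow> m_init | Suc k \<Rightarrow> m k) + (1 - \<beta> n) *\<^sub>R G (x n) (xi n) \<and>
        mhat n = m n /\<^sub>R (1 - \<gamma> ^ (n + 1)) \<and>
        (\<forall>i. h n $ i > 0) \<and>
        diag_matrix (h n) *v d n = - mhat n \<and>
        x (Suc n) = metric_proj X (diag_matrix (h n)) (x n + \<alpha> n *\<^sub>R d n))"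

definition sq_diffs :: "(real^'d) set \<Rightarrow> 'd \<Rightarrow> real set" where
  "sq_diffs X i = {(x $ i - y $ i)\<^sup>2 | x y. x \<in> X \<and> y \<in> X}"

text \<open>The supremum over \<open>n\<close> and \<open>i\<close> of \<open>h n $ i\<close> to the power \<open>-1/2\<close>. It is a function of the
  sample point; the number meant by it is its essential supremum. When the first matrix is
  deterministic and the diagonals are almost surely nondecreasing, this function is almost surely
  constant, so the essential supremum is just its almost sure value.\<close>

definition inv_sqrt_bound :: "'w measure \<Rightarrow> (nat \<Rightarrow> 'w \<Rightarrow> real^'d) \<Rightarrow> ereal" where
  "inv_sqrt_bound P h =
     esssup P (\<lambda>\<omega>. SUP n. ereal (Max (range (\<lambda>i. (h n \<omega> $ i) powr (- 1 / 2)))))"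

end

theory Submission
  imports Defs
begin

text \<open>Let \<open>z\<close> minimise \<open>f\<close> over the compact set \<open>X\<close>. The squared distance of the iterate to \<open>z\<close>,
  measured in the norm of the current diagonal matrix, serves as a Lyapunov function. Multiplying
  the search direction by that matrix gives back the momentum, so the matrix disappears from the
  inner product that drives the descent, and it may depend on the current sample.

  Expanding one projected step yields three terms. The new gradient contributes the inner product
  of the gradient with \<open>x n - z\<close>; its expectation is at least the objective gap, because the
  iterate is independent of the new sample (\<open>stochastic_gradient_moments\<close>). The old momentum
  contributes an error of order \<open>\<beta>\<close>, bounded by the diameter of \<open>X\<close> times its norm. The squared
  step length contributes an error of order \<open>\<alpha>\<close>; this is where the bound on the inverse weights
  enters. The change of norm between two steps costs at most the growth of the weights times \<open>D\<close>;
  subtracting \<open>D\<close> from each squared coordinate (\<open>potential\<close>) makes that cost disappear, and the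
  bounded means of the weights keep the expected potential bounded below. Hence the objective gap
  cannot stay above the ratio of the errors to the gain (\<open>liminf_le_of_descent\<close>).

  One point needs care. The starting point may lie outside \<open>X\<close>, where the gradient is known to be
  integrable but may have an infinite second moment, which later momenta can inherit. The
  momentum is therefore split into the remnant of step zero, which decays like \<open>\<beta> ^ n\<close>, and a
  momentum started from rest at step one (\<open>momentum_decompose\<close>). Only the latter is squared; the
  former is estimated by the diameter of \<open>X\<close> and its total effect is a convergent geometric
  series, which is added to the Lyapunov function (\<open>adaptive_run_descent\<close>).\<close>

section \<open>The projection in a weighted norm\<close>

lemma diag_matrix_mult_nth: "(diag_matrix h *v v) $ i = h $ i * v $ i"
  by (simp add: diag_matrix_def matrix_vector_mult_def if_distrib[of "\<lambda>t. t * _"] cong: if_cong)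

text \<open>The first-order optimality condition of the projection in the norm weighted by
  \<open>h\<close>. The first claim also confirms that the choice in the definition of the
  projection is from a nonempty set.\<close>

lemma metric_proj_variational:
  fixes X :: "(real^'d) set" and x :: "real^'d"
  assumes X: "X \<noteq> {}" "closed X" "convex X" and h: "\<And>i. h $ i > 0"
  defines "p \<equiv> metric_proj X (diag_matrix h) x"
  shows "p \<in> X"
    and "y \<in> X \<Longrightarrow> (\<Sum>i\<in>UNIV. h $ i * (x $ i - p $ i) * (y $ i - p $ i)) \<le> 0"
proof -
  \<comment> \<open>The scaling \<open>s\<close> turns the weighted norm into the Euclidean one, so that the projection
    becomes a Euclidean nearest point of the scaled set.\<close>
  define s :: "real^'d \<Rightarrow> real^'d" where "s v = (\<chi> i. sqrt (h $ i) * v $ i)" for v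
  have lin: "linear s"
    by (rule linearI) (simp_all add: s_def vec_eq_iff algebra_simps)
  have inj: "inj s"
    using h by (auto simp: inj_on_def s_def vec_eq_iff) (metis less_irrefl)
  have inner_s: "s v \<bullet> s w = (\<Sum>i\<in>UNIV. h $ i * v $ i * w $ i)" for v w
  proof -
    have "sqrt (h $ i) * v $ i * (sqrt (h $ i) * w $ i) = h $ i * v $ i * w $ i" for i
    proof -
      have "sqrt (h $ i) * v $ i * (sqrt (h $ i) * w $ i) = (sqrt (h $ i) * sqrt (h $ i)) * v $ i * w $ i"
        by (simp only: mult_ac)
      then show ?thesis using h[of i] by simp
    qed
    then show ?thesis unfolding s_def inner_vec_def by (simp only: vec_lambda_beta inner_real_def)
  qed
  have norm_s: "matrix_norm_of (diag_matrix h) (v - w) = dist (s v) (s w)" for v w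
  proof -
    have "u \<bullet> (diag_matrix h *v u) = s u \<bullet> s u" for u
      unfolding inner_s unfolding inner_vec_def
      by (intro sum.cong) (simp_all add: diag_matrix_mult_nth mult.assoc mult.left_commute)
    then show ?thesis
      by (simp add: matrix_norm_of_def dist_norm norm_eq_sqrt_inner linear_diff[OF lin])
  qed
  have cl: "closed (s ` X)" using X(2) lin inj by (rule closed_injective_linear_image)
  have cv: "convex (s ` X)" using lin X(3) by (rule convex_linear_image)
  obtain q where q: "q \<in> X" "\<And>y. y \<in> X \<Longrightarrow> dist (s x) (s q) \<le> dist (s x) (s y)"
  proof -
    obtain t where "t \<in> s ` X" "\<And>y. y \<in> s ` X \<Longrightarrow> dist (s x) t \<le> dist (s x) y"
      using distance_attains_inf[OF cl, of "s x"] X(1) by blast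
    then show ?thesis using that by blast
  qed
  then have "\<exists>q. q \<in> X \<and> (\<forall>y\<in>X. matrix_norm_of (diag_matrix h) (x - q) \<le> matrix_norm_of (diag_matrix h) (x - y))"
    by (auto simp: norm_s)
  then have p: "p \<in> X \<and> (\<forall>y\<in>X. matrix_norm_of (diag_matrix h) (x - p) \<le> matrix_norm_of (diag_matrix h) (x - y))"
    unfolding p_def metric_proj_def by (rule someI_ex)
  then show "p \<in> X" by blast
  assume y: "y \<in> X"
  have "(s x - s p) \<bullet> (s y - s p) \<le> 0"
    using p y by (intro any_closest_point_dot[OF cv cl]) (auto simp: norm_s)
  then show "(\<Sum>i\<in>UNIV. h $ i * (x $ i - p $ i) * (y $ i - p $ i)) \<le> 0"
    by (simp add: linear_diff[OF lin, symmetric] inner_s)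
qed

text \<open>The negated right-hand side of the linear system is split as \<open>q + r\<close>
  because the two parts are treated differently. The term
  \<open>- \<parallel>x - p\<parallel>\<^sup>2\<close> (in the weighted norm) gained from the variational inequality
  absorbs \<open>r\<close> at the price of a square, so \<open>r\<close> needs a second moment.
  The part \<open>q\<close> is only paired with the displacement \<open>x - p\<close>, which is
  bounded by the diameter, so for \<open>q\<close> a first moment is enough.\<close>

lemma projected_step_descent:
  fixes X :: "(real^'d) set" and x :: "real^'d" and \<alpha> :: real
  assumes X: "X \<noteq> {}" "closed X" "convex X" and h: "\<And>i. h $ i > 0" and z: "z \<in> X"
    and d: "diag_matrix h *v d = - (q + r)"
  defines "p \<equiv> metric_proj X (diag_matrix h) (x + \<alpha> *\<^sub>R d)"
  shows "(\<Sum>i\<in>UNIV. h $ i * (p $ i - z $ i)\<^sup>2)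
    \<le> (\<Sum>i\<in>UNIV. h $ i * (x $ i - z $ i)\<^sup>2) + 2 * \<alpha> * ((q + r) \<bullet> (z - x))
      + 2 * \<alpha> * (q \<bullet> (x - p)) + \<alpha>\<^sup>2 * (\<Sum>i\<in>UNIV. (r $ i)\<^sup>2 / h $ i)"
proof -
  have d_nth: "h $ i * d $ i = - (q $ i + r $ i)" for i
    using arg_cong[OF d, of "\<lambda>v. v $ i"] by (simp add: diag_matrix_mult_nth)
  \<comment> \<open>Coordinate by coordinate, with \<open>s = x - p\<close>: the three-point identity for \<open>p, x, z\<close> leaves
    \<open>- h s\<^sup>2\<close>, against which the part \<open>r\<close> of the direction is completed to a square. The last
    summand below is the one whose sum the variational inequality controls.\<close>
  have coord: "h $ i * (p $ i - z $ i)\<^sup>2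
      \<le> h $ i * (x $ i - z $ i)\<^sup>2 + 2 * \<alpha> * ((q $ i + r $ i) * (z $ i - x $ i))
        + 2 * \<alpha> * (q $ i * (x $ i - p $ i)) + \<alpha>\<^sup>2 * ((r $ i)\<^sup>2 / h $ i)
        + 2 * (h $ i * ((x + \<alpha> *\<^sub>R d) $ i - p $ i) * (z $ i - p $ i))" for i
  proof -
    define s where "s = x $ i - p $ i"
    have "0 \<le> h $ i * (s - \<alpha> * (r $ i / h $ i))\<^sup>2"
      using h[of i] by (simp add: less_imp_le)
    also have "\<dots> = h $ i * s\<^sup>2 - 2 * \<alpha> * (r $ i * s) + \<alpha>\<^sup>2 * ((r $ i)\<^sup>2 / h $ i)"
      using h[of i] by (simp add: field_simps power2_eq_square)
    finally have young: "2 * \<alpha> * (r $ i * s) - h $ i * s\<^sup>2 \<le> \<alpha>\<^sup>2 * ((r $ i)\<^sup>2 / h $ i)" by simp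
    have "h $ i * ((x + \<alpha> *\<^sub>R d) $ i - p $ i) * (z $ i - p $ i)
        = h $ i * s * (z $ i - p $ i) + \<alpha> * (h $ i * d $ i) * (z $ i - p $ i)"
      by (simp add: s_def algebra_simps)
    also have "\<dots> = h $ i * s * (z $ i - p $ i) - \<alpha> * (q $ i + r $ i) * (z $ i - p $ i)"
      unfolding d_nth by (simp add: algebra_simps)
    finally have inner: "h $ i * ((x + \<alpha> *\<^sub>R d) $ i - p $ i) * (z $ i - p $ i)
        = h $ i * s * (z $ i - p $ i) - \<alpha> * (q $ i + r $ i) * (z $ i - p $ i)" .
    have "h $ i * (p $ i - z $ i)\<^sup>2 = h $ i * (x $ i - z $ i)\<^sup>2 - h $ i * s\<^sup>2
        + 2 * (h $ i * s * (z $ i - p $ i))"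
      by (simp add: s_def power2_eq_square algebra_simps)
    also have "\<dots> = h $ i * (x $ i - z $ i)\<^sup>2 + 2 * \<alpha> * ((q $ i + r $ i) * (z $ i - x $ i))
        + 2 * \<alpha> * (q $ i * s) + (2 * \<alpha> * (r $ i * s) - h $ i * s\<^sup>2)
        + 2 * (h $ i * ((x + \<alpha> *\<^sub>R d) $ i - p $ i) * (z $ i - p $ i))"
      unfolding inner by (simp add: s_def algebra_simps)
    finally show ?thesis using young by (simp add: s_def)
  qed
  have "(\<Sum>i\<in>UNIV. h $ i * (p $ i - z $ i)\<^sup>2)
      \<le> (\<Sum>i\<in>UNIV. h $ i * (x $ i - z $ i)\<^sup>2) + 2 * \<alpha> * ((q + r) \<bullet> (z - x))
        + 2 * \<alpha> * (q \<bullet> (x - p)) + \<alpha>\<^sup>2 * (\<Sum>i\<in>UNIV. (r $ i)\<^sup>2 / h $ i)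
        + 2 * (\<Sum>i\<in>UNIV. h $ i * ((x + \<alpha> *\<^sub>R d) $ i - p $ i) * (z $ i - p $ i))"
    using sum_mono[where K = UNIV and f = "\<lambda>i. h $ i * (p $ i - z $ i)\<^sup>2", OF coord]
    by (simp add: sum.distrib sum_distrib_left[symmetric] inner_vec_def del: times_divide_eq_right)
  moreover have "(\<Sum>i\<in>UNIV. h $ i * ((x + \<alpha> *\<^sub>R d) $ i - p $ i) * (z $ i - p $ i)) \<le> 0"
    unfolding p_def using X h z by (rule metric_proj_variational(2))
  ultimately show ?thesis by linarith
qed

section \<open>The diameter of the feasible set\<close>

lemma sq_diffs_bound:
  assumes bdd: "\<And>i. bdd_above (sq_diffs X i)" and D: "D = Max (range (\<lambda>i. Sup (sq_diffs X i)))"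
    and "y \<in> X" "w \<in> (X :: (real^'d) set)"
  shows "(y $ i - w $ i)\<^sup>2 \<le> D"
proof -
  have "(y $ i - w $ i)\<^sup>2 \<le> Sup (sq_diffs X i)"
    using assms(3,4) by (intro cSup_upper bdd) (auto simp: sq_diffs_def)
  also have "\<dots> \<le> D" unfolding D by (rule Max_ge) auto
  finally show ?thesis .
qed

lemma norm_diff_le_of_coords:
  assumes "\<And>i. ((v :: real^'d) $ i)\<^sup>2 \<le> D"
  shows "norm v \<le> sqrt (D * real CARD('d))"
proof -
  have "(\<Sum>i\<in>UNIV. (v $ i)\<^sup>2) \<le> D * real CARD('d)"
    using sum_mono[of UNIV "\<lambda>i. (v $ i)\<^sup>2" "\<lambda>_. D"] assms by (simp add: mult.commute)
  then show ?thesis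
    by (simp add: norm_vec_def L2_set_def)
qed

section \<open>Momentum and potential along a sample path\<close>

text \<open>Exponential averaging of \<open>g\<close> started from zero: the momentum without the
  memory of its initial value.\<close>

primrec momentum_from_rest :: "real \<Rightarrow> (nat \<Rightarrow> real^'d) \<Rightarrow> nat \<Rightarrow> real^'d" where
  "momentum_from_rest \<beta> g 0 = 0"
| "momentum_from_rest \<beta> g (Suc n) = \<beta> *\<^sub>R momentum_from_rest \<beta> g n + (1 - \<beta>) *\<^sub>R g n"

lemma momentum_decompose:
  assumes "\<And>n. m (Suc n) = \<beta> *\<^sub>R m n + (1 - \<beta>) *\<^sub>R g n"
  shows "m n = \<beta> ^ n *\<^sub>R m 0 + momentum_from_rest \<beta> g n"
  by (induction n) (simp_all add: assms scaleR_add_right)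

lemma momentum_from_rest_sq_norm:
  assumes "0 \<le> \<beta>" "\<beta> < 1"
  shows "(norm (momentum_from_rest \<beta> g (Suc n)))\<^sup>2
    \<le> \<beta> * (norm (momentum_from_rest \<beta> g n))\<^sup>2 + (1 - \<beta>) * (norm (g n))\<^sup>2"
proof -
  let ?a = "norm (momentum_from_rest \<beta> g n)" and ?b = "norm (g n)"
  have "norm (momentum_from_rest \<beta> g (Suc n)) \<le> \<beta> * ?a + (1 - \<beta>) * ?b"
    using assms by (auto intro: norm_triangle_le)
  then have "(norm (momentum_from_rest \<beta> g (Suc n)))\<^sup>2 \<le> (\<beta> * ?a + (1 - \<beta>) * ?b)\<^sup>2"
    by (rule power_mono) simp
  also have "\<dots> = \<beta> * ?a\<^sup>2 + (1 - \<beta>) * ?b\<^sup>2 - \<beta> * (1 - \<beta>) * (?a - ?b)\<^sup>2"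
    by (simp add: power2_eq_square algebra_simps)
  also have "\<dots> \<le> \<beta> * ?a\<^sup>2 + (1 - \<beta>) * ?b\<^sup>2" using assms by simp
  finally show ?thesis .
qed

text \<open>The squared weighted norm of \<open>v\<close>, shifted by its upper bound on a set in
  which the squares of all coordinates are at most \<open>D\<close>. The shift makes the value
  decrease when the weights grow, which is what lets the descent telescope although the norm
  changes from step to step.\<close>

definition potential :: "real^'d \<Rightarrow> real \<Rightarrow> real^'d \<Rightarrow> real" where
  "potential h D v = (\<Sum>i\<in>UNIV. h $ i * ((v $ i)\<^sup>2 - D))"

lemma potential_antimono:
  assumes "\<And>i. h $ i \<le> h' $ i" "\<And>i. (v $ i)\<^sup>2 \<le> D"
  shows "potential h' D v \<le> potential h D v"
  unfolding potential_def using assms by (intro sum_mono mult_right_mono_neg) auto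

lemma adaptive_run_mem:
  assumes "adaptive_run X G \<alpha> \<beta> \<gamma> x_init m_init xi h x" "X \<noteq> {}" "closed X" "convex X"
  shows "x (Suc n) \<in> X"
  using assms unfolding adaptive_run_def by (metis metric_proj_variational(1))

text \<open>One step of the algorithm along one sample path, starting from an iterate that is
  already in \<open>X\<close>. The potential may grow only by a term in the square and a term in
  the norm of the momentum from rest. The iterate \<open>x 0\<close> may lie outside
  \<open>X\<close>, where the second moment of the oracle is unknown; the gradient taken there
  survives in all later momenta with weight \<open>\<beta> ^ n\<close>, and the geometric summand
  of \<open>\<Phi>\<close> pays in advance for all of its effects.\<close>

lemma adaptive_run_descent:
  fixes X :: "(real^'d) set"
  assumes run: "adaptive_run X G (\<lambda>_. \<alpha>) (\<lambda>_. \<beta>) \<gamma> x_init m_init xi h x"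
    and X: "X \<noteq> {}" "closed X" "convex X" and z: "z \<in> X"
    and par: "0 \<le> \<alpha>" "0 \<le> \<beta>" "\<beta> < 1" "0 \<le> \<gamma>" "\<gamma> < 1"
    and D: "\<And>y w i. y \<in> X \<Longrightarrow> w \<in> X \<Longrightarrow> (y $ i - w $ i)\<^sup>2 \<le> D"
    and mono: "\<And>i. h (Suc n) $ i \<le> h (Suc (Suc n)) $ i"
    and C: "\<And>i. 1 / h (Suc n) $ i \<le> C"
  defines "R \<equiv> sqrt (D * real CARD('d))"
    and "g \<equiv> \<lambda>k. G (x (Suc k)) (xi (Suc k))"
    and "\<mu>0 \<equiv> norm (\<beta> *\<^sub>R m_init + (1 - \<beta>) *\<^sub>R G x_init (xi 0))"
  defines "\<Phi> \<equiv> \<lambda>n. potential (h (Suc n)) D (x (Suc n) - z)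
      + 4 * \<alpha> * R / ((1 - \<gamma>) * (1 - \<beta>)) * \<beta> ^ Suc n * \<mu>0"
  shows "\<Phi> (Suc n) + 2 * \<alpha> * (1 - \<beta>) / (1 - \<gamma> ^ (n + 2)) * (g n \<bullet> (x (Suc n) - z))
    \<le> \<Phi> n + \<alpha>\<^sup>2 * C / (1 - \<gamma>)\<^sup>2 * (norm (momentum_from_rest \<beta> g (Suc n)))\<^sup>2
      + 2 * \<alpha> * \<beta> * R / (1 - \<gamma>) * norm (momentum_from_rest \<beta> g n)"
proof -
  define r where "r = momentum_from_rest \<beta> g"
  define c where "c = 1 - \<gamma> ^ (n + 2)"
  from run obtain m mhat d where m: "\<And>n. m n = \<beta> *\<^sub>R (case n of 0 \<Rightarrow> m_init | Suc k \<Rightarrow> m k) + (1 - \<beta>) *\<^sub>R G (x n) (xi n)"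
    and mhat: "\<And>n. mhat n = m n /\<^sub>R (1 - \<gamma> ^ (n + 1))"
    and h: "\<And>n i. h n $ i > 0"
    and d: "\<And>n. diag_matrix (h n) *v d n = - mhat n"
    and step: "\<And>n. x (Suc n) = metric_proj X (diag_matrix (h n)) (x n + \<alpha> *\<^sub>R d n)"
    and x0: "x 0 = x_init"
    unfolding adaptive_run_def by metis
  have m0: "norm (m 0) = \<mu>0" by (simp add: m[of 0] x0 \<mu>0_def)
  have m_Suc: "m (Suc n) = \<beta> *\<^sub>R m n + (1 - \<beta>) *\<^sub>R g n" for n
    by (simp add: m[of "Suc n"] g_def)
  have m_dec: "m n = \<beta> ^ n *\<^sub>R m 0 + r n" for n
    unfolding r_def using m_Suc by (rule momentum_decompose)
  have "\<gamma> ^ (n + 2) \<le> \<gamma> ^ 1" using par by (intro power_decreasing) auto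
  then have c: "1 - \<gamma> \<le> c" "0 < c" using par by (auto simp: c_def)
  have C0: "0 \<le> C" using C[of undefined] h[of "Suc n" undefined]
    by (meson divide_pos_pos less_imp_le order_trans zero_less_one)
  define y where "y = x (Suc n)"
  define p where "p = x (Suc (Suc n))"
  have memX: "x (Suc k) \<in> X" for k using run X by (rule adaptive_run_mem)
  have yp: "y \<in> X" "p \<in> X" unfolding y_def p_def by (rule memX)+
  have R: "norm (v - w) \<le> R" if "v \<in> X" "w \<in> X" for v w
    unfolding R_def using D[OF that] by (intro norm_diff_le_of_coords) simp
  have R0: "0 \<le> R" using R[OF z z] by simp
  define H where "H = h (Suc n)"
  have Hpos: "H $ i > 0" for i by (simp add: H_def h)
  \<comment> \<open>The bias-corrected momentum is \<open>q + s\<close>: the remnant of step zero and the part built from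
    later gradients.\<close>
  define q where "q = (\<beta> ^ Suc n / c) *\<^sub>R m 0"
  define s where "s = (1 / c) *\<^sub>R r (Suc n)"
  have qs: "q + s = (1 / c) *\<^sub>R m (Suc n)"
    by (simp add: m_dec[of "Suc n"] q_def s_def scaleR_add_right)
  have nq: "norm q = \<beta> ^ Suc n / c * \<mu>0" using c par by (simp add: q_def m0)
  have dqs: "diag_matrix H *v d (Suc n) = - (q + s)"
    unfolding H_def d mhat qs c_def by (simp add: divide_inverse)
  have p_eq: "metric_proj X (diag_matrix H) (y + \<alpha> *\<^sub>R d (Suc n)) = p"
    by (simp add: p_def y_def H_def step[symmetric])
  note desc = projected_step_descent[OF X Hpos z dqs, where x = y and \<alpha> = \<alpha>, unfolded p_eq]
  have young_term: "(\<Sum>i\<in>UNIV. (s $ i)\<^sup>2 / H $ i) \<le> C / (1 - \<gamma>)\<^sup>2 * (norm (r (Suc n)))\<^sup>2"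
  proof -
    have "(\<Sum>i\<in>UNIV. (s $ i)\<^sup>2 / H $ i) \<le> (\<Sum>i\<in>UNIV. C * (s $ i)\<^sup>2)"
    proof (rule sum_mono)
      fix i
      show "(s $ i)\<^sup>2 / H $ i \<le> C * (s $ i)\<^sup>2"
        using mult_right_mono[OF C[of i], of "(s $ i)\<^sup>2"] by (simp add: H_def)
    qed
    also have "\<dots> = C * (norm s)\<^sup>2"
      unfolding power2_norm_eq_inner inner_vec_def
      by (simp add: sum_distrib_left[symmetric] power2_eq_square)
    also have "\<dots> = C * ((norm (r (Suc n)))\<^sup>2 / c\<^sup>2)"
      by (simp add: s_def power_mult_distrib power_divide)
    also have "\<dots> \<le> C * ((norm (r (Suc n)))\<^sup>2 / (1 - \<gamma>)\<^sup>2)"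
      using c par C0 by (intro mult_left_mono divide_left_mono power_mono) auto
    finally show ?thesis by simp
  qed
  have div_c: "t / c \<le> t / (1 - \<gamma>)" if "0 \<le> t" for t
    using c par that by (intro divide_left_mono) auto
  have old_term: "q \<bullet> (y - p) \<le> \<beta> ^ Suc n * R * \<mu>0 / (1 - \<gamma>)"
  proof -
    have "q \<bullet> (y - p) \<le> norm q * norm (y - p)" by (rule norm_cauchy_schwarz)
    also have "\<dots> \<le> norm q * R" using R[OF yp] by (intro mult_left_mono) auto
    also have "\<dots> = \<beta> ^ Suc n * R * \<mu>0 / c" by (simp add: nq)
    also have "\<dots> \<le> \<beta> ^ Suc n * R * \<mu>0 / (1 - \<gamma>)"
      using par R0 by (intro div_c) (auto simp: \<mu>0_def)
    finally show ?thesis .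
  qed
  have grad_term: "(q + s) \<bullet> (z - y)
      \<le> \<beta> * R * (norm (r n) + \<beta> ^ n * \<mu>0) / (1 - \<gamma>) - (1 - \<beta>) / c * (g n \<bullet> (y - z))"
  proof -
    have "m n \<bullet> (z - y) \<le> norm (m n) * norm (z - y)" by (rule norm_cauchy_schwarz)
    also have "\<dots> \<le> (norm (r n) + \<beta> ^ n * \<mu>0) * R"
    proof (intro mult_mono R z yp)
      show "norm (m n) \<le> norm (r n) + \<beta> ^ n * \<mu>0"
        unfolding m_dec[of n] using norm_triangle_ineq[of "r n" "\<beta> ^ n *\<^sub>R m 0"] par
        by (simp add: m0 add.commute)
    qed (use par in \<open>auto simp: \<mu>0_def\<close>)
    finally have "m n \<bullet> (z - y) \<le> (norm (r n) + \<beta> ^ n * \<mu>0) * R" .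
    then have "\<beta> * (m n \<bullet> (z - y)) / c \<le> \<beta> * ((norm (r n) + \<beta> ^ n * \<mu>0) * R) / c"
      using c par by (intro divide_right_mono mult_left_mono) auto
    also have "\<dots> \<le> \<beta> * ((norm (r n) + \<beta> ^ n * \<mu>0) * R) / (1 - \<gamma>)"
      using par R0 by (intro div_c) (auto simp: \<mu>0_def)
    finally have "\<beta> * (m n \<bullet> (z - y)) / c \<le> \<beta> * R * (norm (r n) + \<beta> ^ n * \<mu>0) / (1 - \<gamma>)"
      by (simp add: mult_ac)
    moreover have "(q + s) \<bullet> (z - y) = \<beta> * (m n \<bullet> (z - y)) / c - (1 - \<beta>) / c * (g n \<bullet> (y - z))"
      unfolding qs m_Suc using c by (simp add: inner_simps field_simps)
    ultimately show ?thesis by linarith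
  qed
  define K where "K = 4 * \<alpha> * R / ((1 - \<gamma>) * (1 - \<beta>))"
  \<comment> \<open>The remnant of step zero enters twice, through \<open>old_term\<close> and \<open>grad_term\<close>; \<open>K\<close> is chosen so
    that the decrease of \<open>K * \<beta> ^ Suc n * \<mu>0\<close> from one step to the next is their sum.\<close>
  have K: "K * \<beta> ^ Suc (Suc n) * \<mu>0 + 2 * \<alpha> * (\<beta> * R * (\<beta> ^ n * \<mu>0) / (1 - \<gamma>))
      + 2 * \<alpha> * (\<beta> ^ Suc n * R * \<mu>0 / (1 - \<gamma>)) = K * \<beta> ^ Suc n * \<mu>0"
  proof -
    have "4 * \<alpha> * R / (1 - \<gamma>) = K * (1 - \<beta>)" using par by (simp add: K_def)
    moreover have "2 * \<alpha> * (\<beta> * R * (\<beta> ^ n * \<mu>0) / (1 - \<gamma>)) + 2 * \<alpha> * (\<beta> ^ Suc n * R * \<mu>0 / (1 - \<gamma>))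
        = 4 * \<alpha> * R / (1 - \<gamma>) * \<beta> ^ Suc n * \<mu>0"
      by (simp add: algebra_simps add_divide_distrib[symmetric])
    ultimately have "K * \<beta> ^ Suc (Suc n) * \<mu>0 + 2 * \<alpha> * (\<beta> * R * (\<beta> ^ n * \<mu>0) / (1 - \<gamma>))
        + 2 * \<alpha> * (\<beta> ^ Suc n * R * \<mu>0 / (1 - \<gamma>))
        = K * \<beta> ^ Suc (Suc n) * \<mu>0 + K * (1 - \<beta>) * \<beta> ^ Suc n * \<mu>0"
      by (simp only: add.assoc)
    then show ?thesis by (simp add: algebra_simps)
  qed
  have "potential (h (Suc (Suc n))) D (p - z) \<le> potential H D (p - z)"
    using mono D[OF yp(2) z] by (intro potential_antimono) (auto simp: H_def)
  also have "\<dots> \<le> potential H D (y - z) + 2 * \<alpha> * ((q + s) \<bullet> (z - y))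
      + 2 * \<alpha> * (q \<bullet> (y - p)) + \<alpha>\<^sup>2 * (\<Sum>i\<in>UNIV. (s $ i)\<^sup>2 / H $ i)"
    using desc by (simp add: potential_def right_diff_distrib sum_subtractf)
  also have "\<dots> \<le> potential H D (y - z)
      + 2 * \<alpha> * (\<beta> * R * (norm (r n) + \<beta> ^ n * \<mu>0) / (1 - \<gamma>) - (1 - \<beta>) / c * (g n \<bullet> (y - z)))
      + 2 * \<alpha> * (\<beta> ^ Suc n * R * \<mu>0 / (1 - \<gamma>))
      + \<alpha>\<^sup>2 * (C / (1 - \<gamma>)\<^sup>2 * (norm (r (Suc n)))\<^sup>2)"
    using par by (intro add_mono mult_left_mono grad_term old_term young_term order_refl) auto
  finally have "potential (h (Suc (Suc n))) D (p - z) + K * \<beta> ^ Suc (Suc n) * \<mu>0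
      + 2 * \<alpha> * (1 - \<beta>) / c * (g n \<bullet> (y - z))
    \<le> potential H D (y - z) + (K * \<beta> ^ Suc (Suc n) * \<mu>0 + 2 * \<alpha> * (\<beta> * R * (\<beta> ^ n * \<mu>0) / (1 - \<gamma>))
      + 2 * \<alpha> * (\<beta> ^ Suc n * R * \<mu>0 / (1 - \<gamma>)))
      + \<alpha>\<^sup>2 * C / (1 - \<gamma>)\<^sup>2 * (norm (r (Suc n)))\<^sup>2
      + 2 * \<alpha> * \<beta> * R / (1 - \<gamma>) * norm (r n)"
    by (simp add: algebra_simps add_divide_distrib diff_divide_distrib)
  then show ?thesis
    unfolding K by (simp add: \<Phi>_def K_def p_def y_def H_def r_def c_def)
qed

section \<open>Convexity and gradients\<close>

lemma continuous_on_of_gradient: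
  assumes "\<And>y. GDERIV f y :> g y"
  shows "continuous_on S f"
  using assms by (intro continuous_at_imp_continuous_on ballI) (auto simp: gderiv_def intro: has_derivative_continuous)

text \<open>The one-dimensional tangent inequality along the line from \<open>y\<close> to
  \<open>w\<close>.\<close>

lemma convex_above_gradient:
  fixes f :: "real^'d \<Rightarrow> real"
  assumes f: "convex_on UNIV f" and g: "GDERIV f y :> g"
  shows "f y + g \<bullet> (w - y) \<le> f w"
proof -
  define \<phi> where "\<phi> t = f (y + t *\<^sub>R (w - y))" for t
  have "convex_on UNIV \<phi>"
  proof (rule convex_onI)
    fix t a b :: real assume t: "0 < t" "t < 1"
    have "y + ((1 - t) *\<^sub>R a + t *\<^sub>R b) *\<^sub>R (w - y)
        = (1 - t) *\<^sub>R (y + a *\<^sub>R (w - y)) + t *\<^sub>R (y + b *\<^sub>R (w - y))"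
      by (simp add: algebra_simps)
    then show "\<phi> ((1 - t) *\<^sub>R a + t *\<^sub>R b) \<le> (1 - t) * \<phi> a + t * \<phi> b"
      unfolding \<phi>_def using convex_onD[OF f, of t] t by simp
  qed simp
  moreover have "(\<phi> has_field_derivative g \<bullet> (w - y)) (at 0 within UNIV)"
  proof -
    have "((\<lambda>t. y + t *\<^sub>R (w - y)) has_derivative (\<lambda>t. t *\<^sub>R (w - y))) (at (0::real))"
      by (auto intro!: derivative_eq_intros)
    moreover have "(f has_derivative (\<lambda>v. v \<bullet> g)) (at (y + 0 *\<^sub>R (w - y)))"
      using g by (simp add: gderiv_def)
    ultimately have "(\<phi> has_derivative (\<lambda>t. (t *\<^sub>R (w - y)) \<bullet> g)) (at 0)"
      unfolding \<phi>_def by (rule has_derivative_compose)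
    then show ?thesis
      by (simp add: has_field_derivative_def inner_commute mult_commute_abs)
  qed
  ultimately have "(g \<bullet> (w - y)) * (1 - 0) \<le> \<phi> 1 - \<phi> 0"
    by (intro convex_on_imp_above_tangent[where A = UNIV]) auto
  then show ?thesis by (simp add: \<phi>_def)
qed

lemma convex_on_expectation:
  fixes F :: "'a::real_vector \<Rightarrow> 'z \<Rightarrow> real"
  assumes int: "\<And>y. integrable \<mu> (F y)" and conv: "AE z in \<mu>. convex_on UNIV (\<lambda>y. F y z)"
  shows "convex_on UNIV (\<lambda>y. \<integral>z. F y z \<partial>\<mu>)"
proof (rule convex_onI)
  fix t :: real and a b assume t: "0 < t" "t < 1"
  have "(\<integral>z. F ((1 - t) *\<^sub>R a + t *\<^sub>R b) z \<partial>\<mu>) \<le> (\<integral>z. (1 - t) * F a z + t * F b z \<partial>\<mu>)"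
    using int conv t by (intro integral_mono_AE) (auto elim!: eventually_mono intro: convex_onD)
  then show "(\<integral>z. F ((1 - t) *\<^sub>R a + t *\<^sub>R b) z \<partial>\<mu>) \<le> (1 - t) * (\<integral>z. F a z \<partial>\<mu>) + t * (\<integral>z. F b z \<partial>\<mu>)"
    using int by simp
qed simp

section \<open>Independence of the iterate and the next sample\<close>

text \<open>Independence of two random variables whose values may have different types, which
  \<^const>\<open>prob_space.indep_var\<close> excludes; iterates and samples live in
  different spaces.\<close>

definition (in prob_space) indep_pair ::
  "'b measure \<Rightarrow> ('a \<Rightarrow> 'b) \<Rightarrow> 'c measure \<Rightarrow> ('a \<Rightarrow> 'c) \<Rightarrow> bool" where
  "indep_pair S Y T Z \<longleftrightarrow> Y \<in> measurable M S \<and> Z \<in> measurable M T \<and>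
     distr M (S \<Otimes>\<^sub>M T) (\<lambda>\<omega>. (Y \<omega>, Z \<omega>)) = distr M S Y \<Otimes>\<^sub>M distr M T Z"

lemma (in prob_space) indep_pair_measurable:
  assumes "indep_pair S Y T Z"
  shows "Y \<in> measurable M S" "Z \<in> measurable M T"
  using assms by (auto simp: indep_pair_def)

lemma (in prob_space) indep_pair_distr:
  assumes "indep_pair S Y T Z"
  shows "distr M (S \<Otimes>\<^sub>M T) (\<lambda>\<omega>. (Y \<omega>, Z \<omega>)) = distr M S Y \<Otimes>\<^sub>M distr M T Z"
  using assms by (auto simp: indep_pair_def)

text \<open>Independence allows averaging over the second variable while the first one is frozen
  (Tonelli for the product law).\<close>

lemma (in prob_space) nn_integral_indep_freeze:
  assumes ind: "indep_pair S Y T Z" and g[measurable]: "g \<in> borel_measurable (S \<Otimes>\<^sub>M T)"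
  shows "(\<integral>\<^sup>+\<omega>. g (Y \<omega>, Z \<omega>) \<partial>M) = (\<integral>\<^sup>+\<omega>. (\<integral>\<^sup>+z. g (Y \<omega>, z) \<partial>distr M T Z) \<partial>M)"
proof -
  have [measurable]: "Y \<in> measurable M S" "Z \<in> measurable M T"
    by (rule indep_pair_measurable[OF ind])+
  interpret Z: prob_space "distr M T Z" by (rule prob_space_distr) simp
  have g': "g \<in> borel_measurable (distr M S Y \<Otimes>\<^sub>M distr M T Z)" by simp
  have "(\<integral>\<^sup>+\<omega>. g (Y \<omega>, Z \<omega>) \<partial>M) = integral\<^sup>N (distr M (S \<Otimes>\<^sub>M T) (\<lambda>\<omega>. (Y \<omega>, Z \<omega>))) g"
    by (subst nn_integral_distr) auto
  also have "\<dots> = (\<integral>\<^sup>+y. \<integral>\<^sup>+z. g (y, z) \<partial>distr M T Z \<partial>distr M S Y)"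
    unfolding indep_pair_distr[OF ind] by (rule Z.nn_integral_fst[OF g', symmetric])
  also have "\<dots> = (\<integral>\<^sup>+\<omega>. (\<integral>\<^sup>+z. g (Y \<omega>, z) \<partial>distr M T Z) \<partial>M)"
    by (rule nn_integral_distr) (use Z.borel_measurable_nn_integral_fst[OF g'] in auto)
  finally show ?thesis .
qed

text \<open>The signed version, where the integrability of the composite replaces
  nonnegativity.\<close>

lemma (in prob_space) integral_indep_freeze:
  fixes g :: "_ \<Rightarrow> real"
  assumes ind: "indep_pair S Y T Z" and g[measurable]: "g \<in> borel_measurable (S \<Otimes>\<^sub>M T)"
    and int: "integrable M (\<lambda>\<omega>. g (Y \<omega>, Z \<omega>))"
  shows "integrable M (\<lambda>\<omega>. \<integral>z. g (Y \<omega>, z) \<partial>distr M T Z)"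
    and "(\<integral>\<omega>. g (Y \<omega>, Z \<omega>) \<partial>M) = (\<integral>\<omega>. (\<integral>z. g (Y \<omega>, z) \<partial>distr M T Z) \<partial>M)"
proof -
  have [measurable]: "Y \<in> measurable M S" "Z \<in> measurable M T"
    by (rule indep_pair_measurable[OF ind])+
  interpret Y: prob_space "distr M S Y" by (rule prob_space_distr) simp
  interpret Z: prob_space "distr M T Z" by (rule prob_space_distr) simp
  interpret YZ: pair_sigma_finite "distr M S Y" "distr M T Z" ..
  have "integrable (distr M (S \<Otimes>\<^sub>M T) (\<lambda>\<omega>. (Y \<omega>, Z \<omega>))) g"
    using int by (subst integrable_distr_eq) auto
  then have int': "integrable (distr M S Y \<Otimes>\<^sub>M distr M T Z) g"
    unfolding indep_pair_distr[OF ind] .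
  from YZ.integrable_fst'[OF int']
  show int1: "integrable M (\<lambda>\<omega>. \<integral>z. g (Y \<omega>, z) \<partial>distr M T Z)"
    by (rule integrable_distr[rotated]) simp
  have "(\<integral>\<omega>. g (Y \<omega>, Z \<omega>) \<partial>M) = integral\<^sup>L (distr M (S \<Otimes>\<^sub>M T) (\<lambda>\<omega>. (Y \<omega>, Z \<omega>))) g"
    by (subst integral_distr) auto
  also have "\<dots> = (\<integral>y. \<integral>z. g (y, z) \<partial>distr M T Z \<partial>distr M S Y)"
    unfolding indep_pair_distr[OF ind] by (rule YZ.integral_fst'[OF int', symmetric])
  also have "\<dots> = (\<integral>\<omega>. (\<integral>z. g (Y \<omega>, z) \<partial>distr M T Z) \<partial>M)"
    by (rule integral_distr)
      (use borel_measurable_integrable[OF YZ.integrable_fst'[OF int']] in auto)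
  finally show "(\<integral>\<omega>. g (Y \<omega>, Z \<omega>) \<partial>M) = (\<integral>\<omega>. (\<integral>z. g (Y \<omega>, z) \<partial>distr M T Z) \<partial>M)" .
qed

text \<open>What makes the stochastic gradient conditionally unbiased: an iterate that depends
  only on the samples before time \<open>n\<close> is independent of the sample at time
  \<open>n\<close>.\<close>

lemma (in prob_space) adapted_indep_next:
  assumes ind: "indep_vars (\<lambda>_. N) \<xi> UNIV"
    and \<phi>[measurable]: "\<phi> \<in> measurable (PiM {..<n} (\<lambda>_. N)) S"
    and x: "\<And>\<omega>. \<omega> \<in> space M \<Longrightarrow> x \<omega> = \<phi> (\<lambda>k\<in>{..<n}. \<xi> k \<omega>)"
  shows "indep_pair S x N (\<xi> (n :: nat))"
proof -
  \<comment> \<open>The past \<open>Y\<close> and the present \<open>Z\<close> are both functions on sets of indices, so the general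
    independence results apply to them; the claim is the image of their joint law.\<close>
  define Y where "Y \<omega> = restrict (\<lambda>i. \<xi> i \<omega>) {..<n}" for \<omega>
  define Z where "Z \<omega> = restrict (\<lambda>i. \<xi> i \<omega>) {n}" for \<omega>
  have "indep_var (PiM {..<n} (\<lambda>_. N)) Y (PiM {n} (\<lambda>_. N)) Z"
    unfolding Y_def Z_def by (rule indep_var_restrict[OF ind]) auto
  then have [measurable]: "Y \<in> measurable M (PiM {..<n} (\<lambda>_. N))" "Z \<in> measurable M (PiM {n} (\<lambda>_. N))"
    and joint: "distr M (PiM {..<n} (\<lambda>_. N)) Y \<Otimes>\<^sub>M distr M (PiM {n} (\<lambda>_. N)) Z
      = distr M (PiM {..<n} (\<lambda>_. N) \<Otimes>\<^sub>M PiM {n} (\<lambda>_. N)) (\<lambda>\<omega>. (Y \<omega>, Z \<omega>))"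
    by (auto simp: indep_var_distribution_eq)
  have [measurable]: "(\<lambda>w. w n) \<in> measurable (PiM {n} (\<lambda>_. N)) N"
    by (rule measurable_component_singleton) simp
  have x_eq: "x \<omega> = \<phi> (Y \<omega>)" if "\<omega> \<in> space M" for \<omega> using x[OF that] by (simp add: Y_def)
  have \<xi>_eq: "\<xi> n \<omega> = Z \<omega> n" for \<omega> by (simp add: Z_def)
  have x_meas: "x \<in> measurable M S" by (subst measurable_cong[OF x_eq]) auto
  have \<xi>_meas: "\<xi> n \<in> measurable M N" unfolding \<xi>_eq[abs_def] by measurable
  have distr_x: "distr M S x = distr (distr M (PiM {..<n} (\<lambda>_. N)) Y) S \<phi>"
    by (subst distr_distr) (auto intro!: distr_cong simp: x_eq)
  have distr_\<xi>: "distr M N (\<xi> n) = distr (distr M (PiM {n} (\<lambda>_. N)) Z) N (\<lambda>w. w n)"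
    by (subst distr_distr) (auto intro!: distr_cong simp: \<xi>_eq)
  interpret \<xi>: prob_space "distr M N (\<xi> n)" by (rule prob_space_distr) (rule \<xi>_meas)
  have "distr M S x \<Otimes>\<^sub>M distr M N (\<xi> n)
      = distr (distr M (PiM {..<n} (\<lambda>_. N)) Y \<Otimes>\<^sub>M distr M (PiM {n} (\<lambda>_. N)) Z) (S \<Otimes>\<^sub>M N)
          (\<lambda>(v, w). (\<phi> v, w n))"
    unfolding distr_x distr_\<xi>
    by (rule pair_measure_distr) (auto simp: distr_\<xi>[symmetric] \<xi>.sigma_finite_measure_axioms)
  also have "\<dots> = distr M (S \<Otimes>\<^sub>M N) (\<lambda>\<omega>. (\<phi> (Y \<omega>), Z \<omega> n))"
    unfolding joint by (subst distr_distr) (auto simp: comp_def)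
  also have "\<dots> = distr M (S \<Otimes>\<^sub>M N) (\<lambda>\<omega>. (x \<omega>, \<xi> n \<omega>))"
    by (rule distr_cong) (auto simp: x_eq \<xi>_eq)
  finally show ?thesis using x_meas \<xi>_meas by (simp add: indep_pair_def)
qed

section \<open>The bound on the inverse weights\<close>

lemma inv_sqrt_bound_measurable:
  fixes h :: "nat \<Rightarrow> 'w \<Rightarrow> real^'d"
  assumes [measurable]: "\<And>n. h n \<in> borel_measurable P"
  shows "(\<lambda>\<omega>. SUP n. ereal (Max (range (\<lambda>i. (h n \<omega> $ i) powr (- 1 / 2))))) \<in> borel_measurable P"
proof -
  have "(\<lambda>\<omega>. h n \<omega> $ i) \<in> borel_measurable P" for n i
    by (rule measurable_compose[OF assms borel_measurable_continuous_onI])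
       (intro continuous_intros)
  then show ?thesis
    by (intro borel_measurable_SUP borel_measurable_ereal borel_measurable_Max) auto
qed

text \<open>The entries \<open>h n \<omega> $ i\<close> enter the descent only through their
  inverses, so the essential supremum is used squared.\<close>

lemma AE_inverse_le_inv_sqrt_bound:
  fixes h :: "nat \<Rightarrow> 'w \<Rightarrow> real^'d"
  assumes B: "inv_sqrt_bound P h = ereal B" and pos: "\<And>n \<omega> i. \<omega> \<in> space P \<Longrightarrow> h n \<omega> $ i > 0"
  shows "AE \<omega> in P. \<forall>n i. 1 / h n \<omega> $ i \<le> B\<^sup>2"
proof -
  have "AE \<omega> in P. (SUP n. ereal (Max (range (\<lambda>i. (h n \<omega> $ i) powr (- 1 / 2))))) \<le> ereal B"
    unfolding B[symmetric] inv_sqrt_bound_def by (rule esssup_AE)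
  then show ?thesis
  proof (rule AE_mp, intro AE_I2 impI allI)
    fix \<omega> n i
    assume \<omega>: "\<omega> \<in> space P"
      and le: "(SUP n. ereal (Max (range (\<lambda>i. (h n \<omega> $ i) powr (- 1 / 2))))) \<le> ereal B"
    have "(h n \<omega> $ i) powr (- 1 / 2) \<le> Max (range (\<lambda>i. (h n \<omega> $ i) powr (- 1 / 2)))"
      by (rule Max_ge) auto
    also have "ereal \<dots> \<le> ereal B" using le by (meson SUP_upper UNIV_I order_trans)
    finally have "((h n \<omega> $ i) powr (- 1 / 2))\<^sup>2 \<le> B\<^sup>2" by (intro power_mono) auto
    moreover have "((h n \<omega> $ i) powr (- 1 / 2))\<^sup>2 = 1 / h n \<omega> $ i"
      using pos[OF \<omega>, of n i] by (simp add: power2_eq_square powr_add[symmetric] powr_minus_divide)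
    ultimately show "1 / h n \<omega> $ i \<le> B\<^sup>2" by simp
  qed
qed

text \<open>Along almost every path the weights never fall below their common initial
  values.\<close>

lemma inv_sqrt_bound_finite:
  fixes h :: "nat \<Rightarrow> 'w \<Rightarrow> real^'d"
  assumes meas: "\<And>n. h n \<in> borel_measurable P"
    and pos: "\<And>i. h_init $ i > 0" and init: "\<And>\<omega>. \<omega> \<in> space P \<Longrightarrow> h 0 \<omega> = h_init"
    and mono: "\<And>n i. AE \<omega> in P. h (Suc n) \<omega> $ i \<ge> h n \<omega> $ i"
  shows "inv_sqrt_bound P h < \<infinity>"
proof -
  have "AE \<omega> in P. \<forall>n i. h n \<omega> $ i \<le> h (Suc n) \<omega> $ i"
    using mono by (simp add: AE_all_countable)
  then have "AE \<omega> in P. (SUP n. ereal (Max (range (\<lambda>i. (h n \<omega> $ i) powr (- 1 / 2)))))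
      \<le> ereal (Max (range (\<lambda>i. (h_init $ i) powr (- 1 / 2))))"
  proof (rule AE_mp, intro AE_I2 impI SUP_least)
    fix \<omega> n assume \<omega>: "\<omega> \<in> space P" and mono: "\<forall>n i. h n \<omega> $ i \<le> h (Suc n) \<omega> $ i"
    have "h_init $ i \<le> h n \<omega> $ i" for i
    proof (induction n)
      case (Suc n)
      then show ?case using mono[rule_format, of n i] by linarith
    qed (simp add: init[OF \<omega>])
    then have "(h n \<omega> $ i) powr (- 1 / 2) \<le> (h_init $ i) powr (- 1 / 2)" for i
      using pos[of i] by (intro powr_mono2') auto
    then have "(h n \<omega> $ i) powr (- 1 / 2) \<le> Max (range (\<lambda>i. (h_init $ i) powr (- 1 / 2)))" for i
      by (rule order_trans) (rule Max_ge, auto)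
    then show "ereal (Max (range (\<lambda>i. (h n \<omega> $ i) powr (- 1 / 2))))
        \<le> ereal (Max (range (\<lambda>i. (h_init $ i) powr (- 1 / 2))))"
      by (subst ereal_less_eq(3), subst Max_le_iff) auto
  qed
  then have "inv_sqrt_bound P h \<le> ereal (Max (range (\<lambda>i. (h_init $ i) powr (- 1 / 2))))"
    unfolding inv_sqrt_bound_def by (rule esssup_I[OF inv_sqrt_bound_measurable[OF meas]])
  then show ?thesis by (rule order_le_less_trans) simp
qed

section \<open>Moments\<close>

lemma (in prob_space) first_moment_le:
  fixes r :: "'a \<Rightarrow> 'b::{real_normed_vector, second_countable_topology}"
  assumes [measurable]: "r \<in> borel_measurable M" and int: "integrable M (\<lambda>\<omega>. (norm (r \<omega>))\<^sup>2)"
    and le: "(\<integral>\<omega>. (norm (r \<omega>))\<^sup>2 \<partial>M) \<le> B\<^sup>2" and "B > 0"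
  shows "integrable M (\<lambda>\<omega>. norm (r \<omega>))" "(\<integral>\<omega>. norm (r \<omega>) \<partial>M) \<le> B"
proof -
  \<comment> \<open>Young's inequality in place of the Cauchy--Schwarz inequality for integrals; it is sharp at
    \<open>norm (r \<omega>) = B\<close>.\<close>
  have young: "norm (r \<omega>) \<le> (B\<^sup>2 + (norm (r \<omega>))\<^sup>2) / (2 * B)" for \<omega>
    using sum_squares_bound[of B "norm (r \<omega>)"] \<open>B > 0\<close> by (simp add: field_simps)
  show int1: "integrable M (\<lambda>\<omega>. norm (r \<omega>))"
  proof (rule Bochner_Integration.integrable_bound)
    show "integrable M (\<lambda>\<omega>. (B\<^sup>2 + (norm (r \<omega>))\<^sup>2) / (2 * B))" using int by simp
    show "AE \<omega> in M. norm (norm (r \<omega>)) \<le> norm ((B\<^sup>2 + (norm (r \<omega>))\<^sup>2) / (2 * B))"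
      using young \<open>B > 0\<close> by (intro AE_I2) simp
  qed simp
  have "(\<integral>\<omega>. norm (r \<omega>) \<partial>M) \<le> (\<integral>\<omega>. (B\<^sup>2 + (norm (r \<omega>))\<^sup>2) / (2 * B) \<partial>M)"
    using int young by (intro integral_mono int1) auto
  also have "\<dots> = (B\<^sup>2 + (\<integral>\<omega>. (norm (r \<omega>))\<^sup>2 \<partial>M)) / (2 * B)"
    using int by (simp add: prob_space)
  also have "\<dots> \<le> (B\<^sup>2 + B\<^sup>2) / (2 * B)"
    using le \<open>B > 0\<close> by (intro divide_right_mono) auto
  also have "\<dots> = B" using \<open>B > 0\<close> by (simp add: power2_eq_square)
  finally show "(\<integral>\<omega>. norm (r \<omega>) \<partial>M) \<le> B" .
qed

text \<open>The square of the norm is convex, so an average of gradients inherits their second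
  moment bound.\<close>

lemma (in prob_space) momentum_from_rest_second_moment:
  fixes g :: "nat \<Rightarrow> 'a \<Rightarrow> real^'d"
  assumes \<beta>: "0 \<le> \<beta>" "\<beta> < 1"
    and [measurable]: "\<And>n. g n \<in> borel_measurable M"
    and int: "\<And>n. integrable M (\<lambda>\<omega>. (norm (g n \<omega>))\<^sup>2)"
    and le: "\<And>n. (\<integral>\<omega>. (norm (g n \<omega>))\<^sup>2 \<partial>M) \<le> B\<^sup>2"
  defines "r \<equiv> \<lambda>n \<omega>. momentum_from_rest \<beta> (\<lambda>k. g k \<omega>) n"
  shows "r n \<in> borel_measurable M"
    and "integrable M (\<lambda>\<omega>. (norm (r n \<omega>))\<^sup>2)"
    and "(\<integral>\<omega>. (norm (r n \<omega>))\<^sup>2 \<partial>M) \<le> B\<^sup>2"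
proof -
  have meas: "r n \<in> borel_measurable M" for n
    by (induction n) (simp_all add: r_def)
  then show "r n \<in> borel_measurable M" .
  have "integrable M (\<lambda>\<omega>. (norm (r n \<omega>))\<^sup>2) \<and> (\<integral>\<omega>. (norm (r n \<omega>))\<^sup>2 \<partial>M) \<le> B\<^sup>2"
  proof (induction n)
    case (Suc n)
    have bound: "(norm (r (Suc n) \<omega>))\<^sup>2 \<le> \<beta> * (norm (r n \<omega>))\<^sup>2 + (1 - \<beta>) * (norm (g n \<omega>))\<^sup>2" for \<omega>
      unfolding r_def by (rule momentum_from_rest_sq_norm[OF \<beta>])
    have int': "integrable M (\<lambda>\<omega>. \<beta> * (norm (r n \<omega>))\<^sup>2 + (1 - \<beta>) * (norm (g n \<omega>))\<^sup>2)"
      using Suc int by simp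
    have int_Suc: "integrable M (\<lambda>\<omega>. (norm (r (Suc n) \<omega>))\<^sup>2)"
    proof (rule Bochner_Integration.integrable_bound[OF int'])
      show "(\<lambda>\<omega>. (norm (r (Suc n) \<omega>))\<^sup>2) \<in> borel_measurable M" using meas[of "Suc n"] by measurable
      show "AE \<omega> in M. norm ((norm (r (Suc n) \<omega>))\<^sup>2)
          \<le> norm (\<beta> * (norm (r n \<omega>))\<^sup>2 + (1 - \<beta>) * (norm (g n \<omega>))\<^sup>2)"
        using bound by (intro AE_I2) (auto intro: order_trans[OF _ abs_ge_self])
    qed
    have "(\<integral>\<omega>. (norm (r (Suc n) \<omega>))\<^sup>2 \<partial>M)
        \<le> (\<integral>\<omega>. \<beta> * (norm (r n \<omega>))\<^sup>2 + (1 - \<beta>) * (norm (g n \<omega>))\<^sup>2 \<partial>M)"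
      using int_Suc int' bound by (rule integral_mono)
    also have "\<dots> = \<beta> * (\<integral>\<omega>. (norm (r n \<omega>))\<^sup>2 \<partial>M) + (1 - \<beta>) * (\<integral>\<omega>. (norm (g n \<omega>))\<^sup>2 \<partial>M)"
      using Suc int by simp
    also have "\<dots> \<le> \<beta> * B\<^sup>2 + (1 - \<beta>) * B\<^sup>2"
      using Suc le \<beta> by (intro add_mono mult_left_mono) auto
    also have "\<dots> = B\<^sup>2" by (simp add: algebra_simps)
    finally show ?case using int_Suc by simp
  qed (simp add: r_def)
  then show "integrable M (\<lambda>\<omega>. (norm (r n \<omega>))\<^sup>2)" "(\<integral>\<omega>. (norm (r n \<omega>))\<^sup>2 \<partial>M) \<le> B\<^sup>2" by auto
qed

text \<open>Freezing the iterate turns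
  the pointwise bound on the second moment into one for the sampled gradient, and turns the
  sampled gradient into the true one, to which the tangent inequality at the minimiser
  \<open>z\<close> applies.\<close>

lemma (in prob_space) stochastic_gradient_moments:
  fixes x :: "'a \<Rightarrow> real^'d" and \<zeta> :: "'a \<Rightarrow> 'z" and G :: "real^'d \<Rightarrow> 'z \<Rightarrow> real^'d"
  assumes ind: "indep_pair borel x N \<zeta>" and \<mu>: "distr M N \<zeta> = \<mu>"
    and G: "(\<lambda>(y, z). G y z) \<in> borel_measurable (borel \<Otimes>\<^sub>M N)" "\<And>y. integrable \<mu> (G y)"
    and second: "\<And>y. y \<in> X \<Longrightarrow> (\<integral>\<^sup>+z. ennreal ((norm (G y z))\<^sup>2) \<partial>\<mu>) \<le> ennreal (B\<^sup>2)"
    and B: "B > 0"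
    and xX: "\<And>\<omega>. \<omega> \<in> space M \<Longrightarrow> x \<omega> \<in> X"
    and R: "\<And>y. y \<in> X \<Longrightarrow> norm (y - z) \<le> R"
    and f: "convex_on UNIV f" "\<And>y. GDERIV f y :> (\<integral>s. G y s \<partial>\<mu>)"
    and z: "\<And>y. y \<in> X \<Longrightarrow> f z \<le> f y"
  shows "(\<lambda>\<omega>. G (x \<omega>) (\<zeta> \<omega>)) \<in> borel_measurable M"
    and "integrable M (\<lambda>\<omega>. (norm (G (x \<omega>) (\<zeta> \<omega>)))\<^sup>2)"
    and "(\<integral>\<omega>. (norm (G (x \<omega>) (\<zeta> \<omega>)))\<^sup>2 \<partial>M) \<le> B\<^sup>2"
    and "integrable M (\<lambda>\<omega>. G (x \<omega>) (\<zeta> \<omega>) \<bullet> (x \<omega> - z))"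
    and "(\<integral>\<omega>. f (x \<omega>) - f z \<partial>M) \<le> (\<integral>\<omega>. G (x \<omega>) (\<zeta> \<omega>) \<bullet> (x \<omega> - z) \<partial>M)"
proof -
  note [measurable] = G(1)
  have [measurable]: "x \<in> borel_measurable M" "\<zeta> \<in> measurable M N"
    by (rule indep_pair_measurable[OF ind])+
  have "(\<lambda>\<omega>. (\<lambda>(y, z). G y z) (x \<omega>, \<zeta> \<omega>)) \<in> borel_measurable M"
    by measurable
  then show Gx[measurable]: "(\<lambda>\<omega>. G (x \<omega>) (\<zeta> \<omega>)) \<in> borel_measurable M" by simp
  let ?n = "\<lambda>p. ennreal ((norm ((\<lambda>(y, z). G y z) p))\<^sup>2)"
  have "(\<integral>\<^sup>+\<omega>. ?n (x \<omega>, \<zeta> \<omega>) \<partial>M) = (\<integral>\<^sup>+\<omega>. (\<integral>\<^sup>+s. ?n (x \<omega>, s) \<partial>distr M N \<zeta>) \<partial>M)"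
    by (rule nn_integral_indep_freeze[OF ind]) measurable
  also have "\<dots> \<le> (\<integral>\<^sup>+\<omega>. ennreal (B\<^sup>2) \<partial>M)"
    unfolding \<mu> using second xX by (intro nn_integral_mono) simp
  also have "\<dots> = ennreal (B\<^sup>2)" by (simp add: emeasure_space_1)
  finally have nn: "(\<integral>\<^sup>+\<omega>. ennreal ((norm (G (x \<omega>) (\<zeta> \<omega>)))\<^sup>2) \<partial>M) \<le> ennreal (B\<^sup>2)" by simp
  then show int2: "integrable M (\<lambda>\<omega>. (norm (G (x \<omega>) (\<zeta> \<omega>)))\<^sup>2)"
    by (intro integrableI_bounded) (auto simp: less_top[symmetric] top_unique)
  show le2: "(\<integral>\<omega>. (norm (G (x \<omega>) (\<zeta> \<omega>)))\<^sup>2 \<partial>M) \<le> B\<^sup>2"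
    using nn nn_integral_eq_integral[OF int2] by (simp add: ennreal_le_iff)
  have int1: "integrable M (\<lambda>\<omega>. norm (G (x \<omega>) (\<zeta> \<omega>)))"
    using Gx int2 le2 B by (rule first_moment_le(1))
  show intG: "integrable M (\<lambda>\<omega>. G (x \<omega>) (\<zeta> \<omega>) \<bullet> (x \<omega> - z))"
  proof (rule Bochner_Integration.integrable_bound)
    show "integrable M (\<lambda>\<omega>. norm (G (x \<omega>) (\<zeta> \<omega>)) * R)" using int1 by simp
    show "AE \<omega> in M. norm (G (x \<omega>) (\<zeta> \<omega>) \<bullet> (x \<omega> - z)) \<le> norm (norm (G (x \<omega>) (\<zeta> \<omega>)) * R)"
    proof (rule AE_I2)
      fix \<omega> assume "\<omega> \<in> space M"
      have "\<bar>G (x \<omega>) (\<zeta> \<omega>) \<bullet> (x \<omega> - z)\<bar> \<le> norm (G (x \<omega>) (\<zeta> \<omega>)) * norm (x \<omega> - z)"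
        by (rule Cauchy_Schwarz_ineq2)
      also have "\<dots> \<le> norm (G (x \<omega>) (\<zeta> \<omega>)) * R"
        using R[OF xX[OF \<open>\<omega> \<in> space M\<close>]] by (intro mult_left_mono) auto
      finally show "norm (G (x \<omega>) (\<zeta> \<omega>) \<bullet> (x \<omega> - z)) \<le> norm (norm (G (x \<omega>) (\<zeta> \<omega>)) * R)"
        by simp
    qed
  qed simp
  define df where "df y = (\<integral>s. G y s \<partial>\<mu>)" for y
  let ?g = "\<lambda>p. (\<lambda>(y, s). G y s) p \<bullet> (fst p - z)"
  have g: "?g \<in> borel_measurable (borel \<Otimes>\<^sub>M N)" by measurable
  have inner_df: "(\<integral>s. ?g (y, s) \<partial>distr M N \<zeta>) = df y \<bullet> (y - z)" for y
    unfolding \<mu> df_def using G(2)[of y] by simp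
  have intg: "integrable M (\<lambda>\<omega>. ?g (x \<omega>, \<zeta> \<omega>))" using intG by simp
  note freeze = integral_indep_freeze[OF ind g intg, unfolded inner_df]
  \<comment> \<open>Besides comparing the expectations, this bound makes the objective gap integrable, since
    the gap is nonnegative.\<close>
  have tangent: "f (x \<omega>) - f z \<le> df (x \<omega>) \<bullet> (x \<omega> - z)" for \<omega>
    using convex_above_gradient[OF f(1) f(2)[of "x \<omega>"], of z] by (simp add: df_def inner_diff_right)
  have "continuous_on UNIV f"
    using f(2) by (rule continuous_on_of_gradient)
  then have [measurable]: "f \<in> borel_measurable borel" by (rule borel_measurable_continuous_onI)
  have intf: "integrable M (\<lambda>\<omega>. f (x \<omega>) - f z)"
  proof (rule Bochner_Integration.integrable_bound[OF freeze(1)])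
    show "AE \<omega> in M. norm (f (x \<omega>) - f z) \<le> norm (df (x \<omega>) \<bullet> (x \<omega> - z))"
      using tangent z xX by (intro AE_I2) (smt (verit) real_norm_def)
  qed simp
  show "(\<integral>\<omega>. f (x \<omega>) - f z \<partial>M) \<le> (\<integral>\<omega>. G (x \<omega>) (\<zeta> \<omega>) \<bullet> (x \<omega> - z) \<partial>M)"
    using integral_mono[OF intf freeze(1) tangent] freeze(2) by simp
qed

text \<open>The potential lies between \<open>- D\<close> times the sum of the weights and zero,
  so only the means of the weights matter.\<close>

lemma (in prob_space) potential_integrable:
  fixes H v :: "'a \<Rightarrow> real^'d"
  assumes H: "\<And>i. integrable M (\<lambda>\<omega>. H \<omega> $ i)" and pos: "\<And>\<omega> i. \<omega> \<in> space M \<Longrightarrow> 0 \<le> H \<omega> $ i"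
    and v[measurable]: "v \<in> borel_measurable M"
    and D: "\<And>\<omega> i. \<omega> \<in> space M \<Longrightarrow> (v \<omega> $ i)\<^sup>2 \<le> D"
  shows "integrable M (\<lambda>\<omega>. potential (H \<omega>) D (v \<omega>))"
    and "- (D * (\<Sum>i\<in>UNIV. \<integral>\<omega>. H \<omega> $ i \<partial>M)) \<le> (\<integral>\<omega>. potential (H \<omega>) D (v \<omega>) \<partial>M)"
proof -
  have [measurable]: "(\<lambda>\<omega>. v \<omega> $ i) \<in> borel_measurable M" for i
    by (rule measurable_compose[OF v borel_measurable_continuous_onI]) (intro continuous_intros)
  have int: "integrable M (\<lambda>\<omega>. H \<omega> $ i * ((v \<omega> $ i)\<^sup>2 - D))" for i
  proof (rule Bochner_Integration.integrable_bound)
    show "integrable M (\<lambda>\<omega>. D * H \<omega> $ i)" using H by simp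
    show "(\<lambda>\<omega>. H \<omega> $ i * ((v \<omega> $ i)\<^sup>2 - D)) \<in> borel_measurable M"
      using borel_measurable_integrable[OF H[of i]] by measurable
    show "AE \<omega> in M. norm (H \<omega> $ i * ((v \<omega> $ i)\<^sup>2 - D)) \<le> norm (D * H \<omega> $ i)"
    proof (rule AE_I2)
      fix \<omega> assume \<omega>: "\<omega> \<in> space M"
      have "\<bar>(v \<omega> $ i)\<^sup>2 - D\<bar> \<le> \<bar>D\<bar>" using D[OF \<omega>, of i] zero_le_power2[of "v \<omega> $ i"] by linarith
      then show "norm (H \<omega> $ i * ((v \<omega> $ i)\<^sup>2 - D)) \<le> norm (D * H \<omega> $ i)"
        using mult_left_mono[of "\<bar>(v \<omega> $ i)\<^sup>2 - D\<bar>" "\<bar>D\<bar>" "\<bar>H \<omega> $ i\<bar>"] by (simp add: abs_mult mult.commute)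
    qed
  qed
  then show int_pot: "integrable M (\<lambda>\<omega>. potential (H \<omega>) D (v \<omega>))" by (simp add: potential_def)
  have "- (D * (\<Sum>i\<in>UNIV. \<integral>\<omega>. H \<omega> $ i \<partial>M)) = (\<integral>\<omega>. - (D * (\<Sum>i\<in>UNIV. H \<omega> $ i)) \<partial>M)"
    using H by simp
  also have "\<dots> \<le> (\<integral>\<omega>. potential (H \<omega>) D (v \<omega>) \<partial>M)"
  proof (rule integral_mono[OF _ int_pot])
    show "integrable M (\<lambda>\<omega>. - (D * (\<Sum>i\<in>UNIV. H \<omega> $ i)))" using H by simp
    fix \<omega> assume \<omega>: "\<omega> \<in> space M"
    have "(\<Sum>i\<in>UNIV. H \<omega> $ i * - D) \<le> potential (H \<omega>) D (v \<omega>)"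
      unfolding potential_def using pos[OF \<omega>] by (intro sum_mono mult_left_mono) auto
    then show "- (D * (\<Sum>i\<in>UNIV. H \<omega> $ i)) \<le> potential (H \<omega>) D (v \<omega>)"
      by (simp add: sum_negf sum_distrib_left mult.commute)
  qed
  finally show "- (D * (\<Sum>i\<in>UNIV. \<integral>\<omega>. H \<omega> $ i \<partial>M)) \<le> (\<integral>\<omega>. potential (H \<omega>) D (v \<omega>) \<partial>M)" .
qed

section \<open>Descent in expectation\<close>

text \<open>The telescoping argument: a sequence that is bounded below cannot
  decrease by a fixed positive amount at every step from some index on.\<close>

lemma liminf_le_of_descent:
  fixes u e :: "nat \<Rightarrow> real"
  assumes "s > 0" and bound: "\<And>n. - L \<le> u n" and step: "\<And>n. u (Suc n) + s * e n \<le> u n + K"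
  shows "liminf (\<lambda>n. ereal (e n)) \<le> ereal (K / s)"
proof (rule ccontr)
  assume "\<not> ?thesis"
  then have "ereal (K / s) < liminf (\<lambda>n. ereal (e n))" by simp
  then obtain b where b: "ereal (K / s) < b" "b < liminf (\<lambda>n. ereal (e n))"
    using dense by blast
  then obtain a where a: "b = ereal a" by (cases b) auto
  have "eventually (\<lambda>n. b < ereal (e n)) sequentially" using b(2) by (rule less_LiminfD)
  then obtain N where N: "\<And>n. n \<ge> N \<Longrightarrow> a < e n" by (auto simp: a eventually_sequentially)
  \<comment> \<open>If \<open>e\<close> eventually stayed above some \<open>a > K / s\<close>, each step would lower \<open>u\<close> by at least \<open>\<epsilon>\<close>.\<close>
  define \<epsilon> where "\<epsilon> = s * a - K"
  have \<epsilon>: "\<epsilon> > 0" using b(1) \<open>s > 0\<close> by (simp add: a \<epsilon>_def field_simps)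
  have "u (N + k) \<le> u N - real k * \<epsilon>" for k
  proof (induction k)
    case (Suc k)
    have "s * a \<le> s * e (N + k)" using N[of "N + k"] \<open>s > 0\<close> by simp
    then show ?case using Suc step[of "N + k"] by (simp add: \<epsilon>_def algebra_simps)
  qed simp
  moreover obtain k where "u N + L < real k * \<epsilon>"
    using reals_Archimedean3[OF \<epsilon>] by blast
  ultimately show False using bound[of "N + k"] by (smt (verit))
qed

theorem proposition3p1:
  fixes X :: "(real^'d) set"
    and \<mu> :: "(real^'e) measure" and \<Xi> :: "(real^'e) set"
    and F :: "real^'d \<Rightarrow> real^'e \<Rightarrow> real" and f :: "real^'d \<Rightarrow> real"
    and G :: "real^'d \<Rightarrow> real^'e \<Rightarrow> real^'d"
    and P :: "'w measure" and \<xi> :: "nat \<Rightarrow> 'w \<Rightarrow> real^'e"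
    and h x :: "nat \<Rightarrow> 'w \<Rightarrow> real^'d"
    and x_init m_init :: "real^'d"
    and \<alpha> \<beta> \<gamma> D M \<gamma>t bt Mt fstar :: real
  assumes law: "prob_space \<mu>" "sets \<mu> = sets borel" "AE z in \<mu>. z \<in> \<Xi>"
    and prob: "prob_space P"
    and A1: "X \<noteq> {}" "closed X" "convex X"
    and A2: "\<And>y. integrable \<mu> (F y)"
      "\<And>y. f y = (\<integral>z. F y z \<partial>\<mu>)"
      "AE z in \<mu>. z \<in> \<Xi> \<longrightarrow> cont_differentiable (\<lambda>y. F y z)"
    and h_measurable: "\<And>n. h n \<in> borel_measurable P"
    and A3: "\<And>n i. AE \<omega> in P. h (Suc n) \<omega> $ i \<ge> h n \<omega> $ i"
    and A4: "\<And>i. \<exists>B>0. (SUP n. \<integral>\<^sup>+\<omega>. ennreal (h n \<omega> $ i) \<partial>P) \<le> ennreal B"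
    and A5: "\<And>i. bdd_above (sq_diffs X i)" "D = Max (range (\<lambda>i. Sup (sq_diffs X i)))"
    and C1: "prob_space.indep_vars P (\<lambda>_. borel) \<xi> UNIV" "\<And>n. distr P borel (\<xi> n) = \<mu>"
    and C2: "(\<lambda>(y, z). G y z) \<in> borel_measurable (borel \<Otimes>\<^sub>M borel)"
      "\<And>y. integrable \<mu> (G y)"
      "\<And>y. GDERIV f y :> (\<integral>z. G y z \<partial>\<mu>)"
    and C3: "M > 0" "\<And>y. y \<in> X \<Longrightarrow> (\<integral>\<^sup>+z. ennreal ((norm (G y z))\<^sup>2) \<partial>\<mu>) \<le> ennreal (M\<^sup>2)"
    and F_convex: "AE z in \<mu>. z \<in> \<Xi> \<longrightarrow> convex_on UNIV (\<lambda>y. F y z)"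
    and parameters: "0 < \<alpha>" "\<alpha> < 1" "0 \<le> \<beta>" "\<beta> < 1" "0 \<le> \<gamma>" "\<gamma> < 1"
    and run: "\<And>\<omega>. \<omega> \<in> space P \<Longrightarrow>
      adaptive_run X G (\<lambda>_. \<alpha>) (\<lambda>_. \<beta>) \<gamma> x_init m_init (\<lambda>n. \<xi> n \<omega>) (\<lambda>n. h n \<omega>) (\<lambda>n. x n \<omega>)"
    and x_adapted: "\<And>n. \<exists>\<phi> \<in> borel_measurable (PiM {..<n} (\<lambda>_. borel)).
      \<forall>\<omega>\<in>space P. x n \<omega> = \<phi> (\<lambda>k\<in>{..<n}. \<xi> k \<omega>)"
    and fstar: "fstar = (INF y\<in>X. f y)"
    and \<gamma>t: "\<gamma>t = 1 - \<gamma>"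
    and bt: "bt = 1 - \<beta>"
    and Mt: "Mt \<ge> 0" "Mt\<^sup>2 = max ((norm m_init)\<^sup>2) (M\<^sup>2)"
  shows "liminf (\<lambda>n. ereal (\<integral>\<omega>. f (x n \<omega>) - fstar \<partial>P))
           \<le> (inv_sqrt_bound P h)\<^sup>2 * ereal (Mt\<^sup>2 / (2 * bt * \<gamma>t\<^sup>2) * \<alpha>)
             + ereal (Mt * sqrt (D * real CARD('d)) / (bt * \<gamma>t) * \<beta>)
         \<and> ((\<exists>h_init. \<forall>\<omega>\<in>space P. h 0 \<omega> = h_init) \<longrightarrow> inv_sqrt_bound P h < \<infinity>)"
proof (intro conjI impI)
  interpret prob_space P by (rule prob)
  have run_facts: "h n \<omega> $ i > 0" "x (Suc n) \<omega> \<in> X" if "\<omega> \<in> space P" for n \<omega> i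
    using run[OF that] adaptive_run_mem[OF run[OF that] A1] by (auto simp: adaptive_run_def)
  {
    assume "\<exists>h_init. \<forall>\<omega>\<in>space P. h 0 \<omega> = h_init"
    then obtain h_init where init: "\<And>\<omega>. \<omega> \<in> space P \<Longrightarrow> h 0 \<omega> = h_init" by blast
    obtain \<omega> where "\<omega> \<in> space P" using not_empty by blast
    then have "h_init $ i > 0" for i using run_facts(1)[of \<omega> 0 i] init by simp
    then show "inv_sqrt_bound P h < \<infinity>" using h_measurable init A3 by (intro inv_sqrt_bound_finite)
  }
  define R where "R = sqrt (D * real CARD('d))"
  have D: "(y $ i - w $ i)\<^sup>2 \<le> D" if "y \<in> X" "w \<in> X" for y w i
    using A5 that by (rule sq_diffs_bound)
  have R: "norm (y - w) \<le> R" if "y \<in> X" "w \<in> X" for y w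
    unfolding R_def using D[OF that] by (intro norm_diff_le_of_coords) simp
  have f_convex: "convex_on UNIV f"
  proof -
    have "AE s in \<mu>. convex_on UNIV (\<lambda>y. F y s)" using law(3) F_convex by eventually_elim blast
    then show ?thesis unfolding A2(2)[abs_def] by (rule convex_on_expectation[OF A2(1)])
  qed
  obtain z where z: "z \<in> X" and z_min: "\<And>y. y \<in> X \<Longrightarrow> f z \<le> f y"
  proof -
    obtain w where w: "w \<in> X" using A1(1) by blast
    have "bounded X" unfolding bounded_def using R[OF w] by (auto simp: dist_norm)
    then have "compact X" using A1(2) by (simp add: compact_eq_bounded_closed)
    moreover have "continuous_on X f"
      using C2(3) by (rule continuous_on_of_gradient)
    ultimately show ?thesis using continuous_attains_inf[of X f] A1(1) that by blast
  qed
  have fstar_z: "fstar = f z"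
  proof (rule antisym)
    show "fstar \<le> f z" unfolding fstar by (intro cINF_lower bdd_belowI2[of X "f z"] z_min z)
    show "f z \<le> fstar" unfolding fstar by (intro cINF_greatest A1(1) z_min)
  qed
  show "liminf (\<lambda>n. ereal (\<integral>\<omega>. f (x n \<omega>) - fstar \<partial>P))
           \<le> (inv_sqrt_bound P h)\<^sup>2 * ereal (Mt\<^sup>2 / (2 * bt * \<gamma>t\<^sup>2) * \<alpha>)
             + ereal (Mt * sqrt (D * real CARD('d)) / (bt * \<gamma>t) * \<beta>)"
  proof (cases "\<exists>B. inv_sqrt_bound P h = ereal B")
    case False
    \<comment> \<open>An infinite bound makes the right-hand side infinite, because \<open>\<alpha>\<close> and \<open>Mt\<close> are positive.\<close>
    then have infinite: "(inv_sqrt_bound P h)\<^sup>2 = \<infinity>"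
      by (cases "inv_sqrt_bound P h") (auto simp: power2_eq_square)
    have "Mt\<^sup>2 > 0" using C3(1) by (simp add: Mt(2) less_max_iff_disj)
    moreover define q where "q = Mt\<^sup>2 / (2 * bt * \<gamma>t\<^sup>2) * \<alpha>"
    ultimately have "q > 0" using parameters by (simp add: bt \<gamma>t)
    with infinite show ?thesis unfolding q_def[symmetric] by simp
  next
    case True
    then obtain B where B: "inv_sqrt_bound P h = ereal B" by blast
    define g where "g n \<omega> = G (x (Suc n) \<omega>) (\<xi> (Suc n) \<omega>)" for n \<omega>
    define r where "r n \<omega> = momentum_from_rest \<beta> (\<lambda>k. g k \<omega>) n" for n \<omega>
    have indep: "indep_pair borel (x n) borel (\<xi> n)" for n
    proof -
      obtain \<phi> where "\<phi> \<in> borel_measurable (PiM {..<n} (\<lambda>_. borel))"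
        "\<And>\<omega>. \<omega> \<in> space P \<Longrightarrow> x n \<omega> = \<phi> (\<lambda>k\<in>{..<n}. \<xi> k \<omega>)"
        using x_adapted[of n] by blast
      then show ?thesis by (rule adapted_indep_next[OF C1(1)])
    qed
    have x_meas[measurable]: "x n \<in> borel_measurable P" and \<xi>_meas[measurable]: "\<xi> n \<in> borel_measurable P" for n
      by (rule indep_pair_measurable[OF indep])+
    note grad = stochastic_gradient_moments[OF indep C1(2) C2(1,2) C3(2,1) run_facts(2) R[OF _ z]
        f_convex C2(3) z_min, folded g_def]
    note mom = momentum_from_rest_second_moment[where g = g, OF parameters(3,4) grad(1-3), folded r_def]
    note mom1 = first_moment_le[OF mom C3(1)]

    define \<mu>0 where "\<mu>0 \<omega> = norm (\<beta> *\<^sub>R m_init + (1 - \<beta>) *\<^sub>R G x_init (\<xi> 0 \<omega>))" for \<omega>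
    have \<mu>0_int: "integrable P \<mu>0"
    proof -
      have "integrable (distr P borel (\<xi> 0)) (G x_init)" unfolding C1(2) by (rule C2(2))
      then have "integrable P (\<lambda>\<omega>. G x_init (\<xi> 0 \<omega>))" by (rule integrable_distr[rotated]) simp
      then show ?thesis unfolding \<mu>0_def by simp
    qed
    have "\<forall>i. \<exists>b. \<forall>n. integrable P (\<lambda>\<omega>. h n \<omega> $ i) \<and> (\<integral>\<omega>. h n \<omega> $ i \<partial>P) \<le> b"
    proof
      fix i
      obtain b where b: "b > 0" "(SUP n. \<integral>\<^sup>+\<omega>. ennreal (h n \<omega> $ i) \<partial>P) \<le> ennreal b" using A4 by blast
      have "integrable P (\<lambda>\<omega>. h n \<omega> $ i) \<and> (\<integral>\<omega>. h n \<omega> $ i \<partial>P) \<le> b" for n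
      proof
        have le: "(\<integral>\<^sup>+\<omega>. ennreal (h n \<omega> $ i) \<partial>P) \<le> ennreal b"
          using b(2) by (meson SUP_upper UNIV_I order_trans)
        have meas: "(\<lambda>\<omega>. h n \<omega> $ i) \<in> borel_measurable P"
          by (rule measurable_compose[OF h_measurable borel_measurable_continuous_onI])
             (intro continuous_intros)
        have nonneg: "AE \<omega> in P. 0 \<le> h n \<omega> $ i" using run_facts(1) by (intro AE_I2 less_imp_le)
        show int: "integrable P (\<lambda>\<omega>. h n \<omega> $ i)"
          using meas nonneg le by (intro integrableI_nonneg) (auto simp: le_less_trans[OF _ ennreal_less_top])
        show "(\<integral>\<omega>. h n \<omega> $ i \<partial>P) \<le> b"
          using le nn_integral_eq_integral[OF int nonneg] b(1) by simp
      qed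
      then show "\<exists>b. \<forall>n. integrable P (\<lambda>\<omega>. h n \<omega> $ i) \<and> (\<integral>\<omega>. h n \<omega> $ i \<partial>P) \<le> b" by blast
    qed
    then obtain b where h_int: "\<And>n i. integrable P (\<lambda>\<omega>. h n \<omega> $ i)"
      and h_le: "\<And>n i. (\<integral>\<omega>. h n \<omega> $ i \<partial>P) \<le> b i"
      by metis

    have D0: "0 \<le> D" using D[OF z z, of undefined] by simp
    have R0: "0 \<le> R" using R[OF z z] by simp
    define K where "K = 4 * \<alpha> * R / ((1 - \<gamma>) * (1 - \<beta>))"
    have K0: "0 \<le> K" using parameters R0 by (simp add: K_def)
    \<comment> \<open>The Lyapunov function: squared distance to the minimiser in the current norm, shifted by
      the worst case \<open>D\<close>, plus the account for the momentum left over from step zero.\<close>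
    define \<Phi> where "\<Phi> n \<omega> = potential (h (Suc n) \<omega>) D (x (Suc n) \<omega> - z) + K * \<beta> ^ Suc n * \<mu>0 \<omega>" for n \<omega>
    have pot: "integrable P (\<lambda>\<omega>. potential (h (Suc n) \<omega>) D (x (Suc n) \<omega> - z))"
      "- (D * (\<Sum>i\<in>UNIV. \<integral>\<omega>. h (Suc n) \<omega> $ i \<partial>P)) \<le> (\<integral>\<omega>. potential (h (Suc n) \<omega>) D (x (Suc n) \<omega> - z) \<partial>P)" for n
      using run_facts D[OF _ z] h_int
      by (intro potential_integrable; auto intro: less_imp_le)+
    have \<Phi>_int: "integrable P (\<Phi> n)" for n
      unfolding \<Phi>_def using pot(1) \<mu>0_int by simp
    have \<Phi>_lower: "- (D * (\<Sum>i\<in>UNIV. b i)) \<le> (\<integral>\<omega>. \<Phi> n \<omega> \<partial>P)" for n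
    proof -
      have "- (D * (\<Sum>i\<in>UNIV. b i)) \<le> - (D * (\<Sum>i\<in>UNIV. \<integral>\<omega>. h (Suc n) \<omega> $ i \<partial>P))"
        using h_le D0 by (simp add: mult_left_mono sum_mono)
      also note pot(2)
      also have "(\<integral>\<omega>. potential (h (Suc n) \<omega>) D (x (Suc n) \<omega> - z) \<partial>P) \<le> (\<integral>\<omega>. \<Phi> n \<omega> \<partial>P)"
      proof (rule integral_mono[OF pot(1) \<Phi>_int])
        show "potential (h (Suc n) \<omega>) D (x (Suc n) \<omega> - z) \<le> \<Phi> n \<omega>" for \<omega>
          using K0 parameters by (simp add: \<Phi>_def \<mu>0_def)
      qed
      finally show ?thesis .
    qed

    define c\<^sub>1 where "c\<^sub>1 = \<alpha>\<^sup>2 * B\<^sup>2 / (1 - \<gamma>)\<^sup>2"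
    define c\<^sub>2 where "c\<^sub>2 = 2 * \<alpha> * \<beta> * R / (1 - \<gamma>)"
    have c0: "0 \<le> c\<^sub>1" "0 \<le> c\<^sub>2" using parameters R0 by (simp_all add: c\<^sub>1_def c\<^sub>2_def)
    define a where "a n = 2 * \<alpha> * (1 - \<beta>) / (1 - \<gamma> ^ (n + 2))" for n
    \<comment> \<open>The bias correction only enlarges the coefficient of the objective gap, which is
      nonnegative from the first projected iterate on.\<close>
    have a: "2 * \<alpha> * (1 - \<beta>) \<le> a n" for n
    proof -
      have "\<gamma> ^ (n + 2) \<le> \<gamma> ^ 1" using parameters by (intro power_decreasing) auto
      then have "2 * \<alpha> * (1 - \<beta>) / 1 \<le> a n"
        unfolding a_def using parameters by (intro divide_left_mono) auto
      then show ?thesis by simp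
    qed
    define e where "e n = (\<integral>\<omega>. f (x (Suc n) \<omega>) - fstar \<partial>P)" for n
    have e0: "0 \<le> e n" for n
      unfolding e_def fstar_z using z_min run_facts(2) by (intro Bochner_Integration.integral_nonneg_AE) auto
    have descent: "(\<integral>\<omega>. \<Phi> (Suc n) \<omega> \<partial>P) + 2 * \<alpha> * (1 - \<beta>) * e n
        \<le> (\<integral>\<omega>. \<Phi> n \<omega> \<partial>P) + (c\<^sub>1 * M\<^sup>2 + c\<^sub>2 * M)" for n
    proof -
      have pathwise: "AE \<omega> in P. \<Phi> (Suc n) \<omega> + a n * (g n \<omega> \<bullet> (x (Suc n) \<omega> - z))
          \<le> \<Phi> n \<omega> + c\<^sub>1 * (norm (r (Suc n) \<omega>))\<^sup>2 + c\<^sub>2 * norm (r n \<omega>)"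
      proof -
        have "AE \<omega> in P. \<forall>i. h (Suc n) \<omega> $ i \<le> h (Suc (Suc n)) \<omega> $ i"
          using A3[of "Suc n"] by (simp add: AE_all_countable)
        moreover have "AE \<omega> in P. \<forall>n i. 1 / h n \<omega> $ i \<le> B\<^sup>2"
          using B run_facts(1) by (rule AE_inverse_le_inv_sqrt_bound)
        moreover have "AE \<omega> in P. \<omega> \<in> space P" by (rule AE_space)
        ultimately show ?thesis
        proof eventually_elim
          case (elim \<omega>)
          show ?case
            unfolding \<Phi>_def K_def a_def c\<^sub>1_def c\<^sub>2_def r_def g_def \<mu>0_def R_def
            using parameters D elim
            by (intro adaptive_run_descent[OF run[OF elim(3)] A1 z]) auto
        qed
      qed
      have "2 * \<alpha> * (1 - \<beta>) * e n \<le> a n * e n" using a e0 by (rule mult_right_mono)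
      also have "\<dots> \<le> a n * (\<integral>\<omega>. g n \<omega> \<bullet> (x (Suc n) \<omega> - z) \<partial>P)"
      proof (rule mult_left_mono)
        show "e n \<le> (\<integral>\<omega>. g n \<omega> \<bullet> (x (Suc n) \<omega> - z) \<partial>P)" unfolding e_def fstar_z by (rule grad(5))
        have "0 \<le> 2 * \<alpha> * (1 - \<beta>)" using parameters by simp
        then show "0 \<le> a n" using a by (rule order_trans)
      qed
      finally have "(\<integral>\<omega>. \<Phi> (Suc n) \<omega> \<partial>P) + 2 * \<alpha> * (1 - \<beta>) * e n
          \<le> (\<integral>\<omega>. \<Phi> (Suc n) \<omega> + a n * (g n \<omega> \<bullet> (x (Suc n) \<omega> - z)) \<partial>P)"
        using \<Phi>_int grad(4) by simp
      also have "\<dots> \<le> (\<integral>\<omega>. \<Phi> n \<omega> + c\<^sub>1 * (norm (r (Suc n) \<omega>))\<^sup>2 + c\<^sub>2 * norm (r n \<omega>) \<partial>P)"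
        using \<Phi>_int grad(4) mom(2) mom1(1) pathwise by (intro integral_mono_AE) auto
      also have "\<dots> = (\<integral>\<omega>. \<Phi> n \<omega> \<partial>P) + c\<^sub>1 * (\<integral>\<omega>. (norm (r (Suc n) \<omega>))\<^sup>2 \<partial>P) + c\<^sub>2 * (\<integral>\<omega>. norm (r n \<omega>) \<partial>P)"
        using \<Phi>_int mom(2) mom1(1) by simp
      also have "\<dots> \<le> (\<integral>\<omega>. \<Phi> n \<omega> \<partial>P) + c\<^sub>1 * M\<^sup>2 + c\<^sub>2 * M"
        by (intro add_mono mult_left_mono order_refl mom(3) mom1(2) c0)
      finally show ?thesis by simp
    qed

    have "liminf (\<lambda>n. ereal (\<integral>\<omega>. f (x n \<omega>) - fstar \<partial>P)) = liminf (\<lambda>n. ereal (e n))"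
      unfolding e_def
      using liminf_shift[of "\<lambda>n. ereal (\<integral>\<omega>. f (x n \<omega>) - fstar \<partial>P)"] by simp
    also have "\<dots> \<le> ereal ((c\<^sub>1 * M\<^sup>2 + c\<^sub>2 * M) / (2 * \<alpha> * (1 - \<beta>)))"
      using parameters
      by (intro liminf_le_of_descent[where u = "\<lambda>n. \<integral>\<omega>. \<Phi> n \<omega> \<partial>P", OF _ \<Phi>_lower descent]) simp
    also have "(c\<^sub>1 * M\<^sup>2 + c\<^sub>2 * M) / (2 * \<alpha> * (1 - \<beta>))
        = B\<^sup>2 * (M\<^sup>2 / (2 * bt * \<gamma>t\<^sup>2) * \<alpha>) + M * R / (bt * \<gamma>t) * \<beta>"
    proof -
      have "\<gamma>t \<noteq> 0" "bt \<noteq> 0" "\<alpha> \<noteq> 0" using parameters by (auto simp: bt \<gamma>t)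
      then show ?thesis
        unfolding c\<^sub>1_def c\<^sub>2_def bt[symmetric] \<gamma>t[symmetric] by (simp add: field_simps power2_eq_square)
    qed
    also have "\<dots> \<le> B\<^sup>2 * (Mt\<^sup>2 / (2 * bt * \<gamma>t\<^sup>2) * \<alpha>) + Mt * R / (bt * \<gamma>t) * \<beta>"
    proof -
      have "M\<^sup>2 \<le> Mt\<^sup>2" by (simp add: Mt(2))
      moreover from this have "M \<le> Mt" using Mt(1) by (rule power2_le_imp_le)
      moreover have "bt > 0" "\<gamma>t > 0" using parameters by (auto simp: bt \<gamma>t)
      ultimately show ?thesis using parameters R0
        by (intro add_mono mult_left_mono mult_right_mono divide_right_mono) auto
    qed
    finally show ?thesis by (simp add: B R_def)
  qed
qed

end
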